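(* Let $p, q \in \mathbb{R}[x,y]$ be the polynomials $$p=4x^6y^3+12x^5y^2+12x^4y+4x^3y^2+4x^3+5x^2y+x+y,$$ $$q=-\left(4x^4y^2+8x^3y+4x^2+2xy+1\right)\cdot\left(4x^6y^3+12x^5y^2+12x^4y+4x^3y^2+4x^3+7x^2y+3x+y\right),$$ and let $F=(p,q):\mathbb{R}^2\to\mathbb{R}^2$. Let $\phi:\mathbb{C}\to\mathbb{C}$, $\phi(z)=z^3-3z$, regarded as a map $\mathbb{R}^2\to\mathbb{R}^2$. Then $f=\phi\circ F:\mathbb{R}^2\to\mathbb{R}^2$ is a non-injective, surjective polynomial map whose Jacobian determinant vanishes at no point of $\mathbb{R}^2$.
   Context: $\mathbb{C}$ is treated as $\mathbb{R}^2$ via the standard identification $(u,v)\leftrightarrow u+iv$. A polynomial map $\mathbb{R}^2\to\mathbb{R}^2$ is one whose two components are real polynomials in two variables; its Jacobian determinant is the determinant of its matrix of first-order partial derivatives. *)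

theory Defs
  imports "HOL-Analysis.Analysis"
begin

definition p :: "real \<Rightarrow> real \<Rightarrow> real" where
  "p x y = 4*x^6*y^3 + 12*x^5*y^2 + 12*x^4*y + 4*x^3*y^2 + 4*x^3 + 5*x^2*y + x + y"

definition q :: "real \<Rightarrow> real \<Rightarrow> real" where
  "q x y = - (4*x^4*y^2 + 8*x^3*y + 4*x^2 + 2*x*y + 1) *
    (4*x^6*y^3 + 12*x^5*y^2 + 12*x^4*y + 4*x^3*y^2 + 4*x^3 + 7*x^2*y + 3*x + y)"

definition F :: "real^2 \<Rightarrow> real^2" where
  "F v = vector [p (v $ 1) (v $ 2), q (v $ 1) (v $ 2)]"

definition plane_to_complex :: "real^2 \<Rightarrow> complex" where
  "plane_to_complex v = Complex (v $ 1) (v $ 2)"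

definition complex_to_plane :: "complex \<Rightarrow> real^2" where
  "complex_to_plane z = vector [Re z, Im z]"

definition phi :: "complex \<Rightarrow> complex" where
  "phi z = z^3 - 3 * z"

definition phi_plane :: "real^2 \<Rightarrow> real^2" where
  "phi_plane = complex_to_plane \<circ> phi \<circ> plane_to_complex"

(* real_polynomial_function on real^2 is the closure of the bounded linear functionals
   a * v$1 + b * v$2 and the constants under + and *, i.e. exactly the functions given by
   real polynomials in the two coordinates. *)
definition polynomial_map :: "(real^2 \<Rightarrow> real^2) \<Rightarrow> bool" where
  "polynomial_map f \<longleftrightarrow> (\<forall>i. real_polynomial_function (\<lambda>v. f v $ i))"

end

theory Submission
  imports Defs "HOL-Computational_Algebra.Fundamental_Theorem_Algebra"
begin

text \<open>
  The polynomials become transparent in terms of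
  \<open>h = x (xy + 1)\<close>, \<open>s = 4h\<^sup>2 + 2xy + 1\<close> and \<open>r = p + 2h\<close>: they satisfy
  \<open>q = - s r\<close> and \<open>s\<^sup>2 - r\<^sup>2 = 1 - p\<^sup>2\<close>, which together say
  \<open>(s + i r)\<^sup>2 = 1 - p\<^sup>2 - 2iq\<close>.
  Two conclusions follow.

  First, \<open>det JF = 2 (s\<^sup>2 + r\<^sup>2)\<close>. If \<open>s\<close> and \<open>r\<close> vanish together then \<open>p = -2h\<close> and
  \<open>p\<^sup>2 = 1\<close>, so \<open>4h\<^sup>2 = 1\<close>; but then \<open>s = 0\<close> forces \<open>xy + 1 = 0\<close> and hence \<open>h = 0\<close>, a
  contradiction. So \<open>det JF\<close> has no zero, and \<open>F\<close> omits the two points \<open>(\<plusminus>1, 0)\<close>,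
  at which \<open>s + i r\<close> would have to be \<open>0\<close>.

  Second, these are the only omitted points. Given any other \<open>(p, q)\<close>, the two square roots
  \<open>\<plusminus>(s + i r)\<close> are nonzero, and each determines \<open>h\<close> and \<open>xy\<close>, from which \<open>x\<close> and \<open>y\<close>
  can be recovered outside a degenerate curve (lemma \<open>solve_for_x_y\<close>). Both roots are
  degenerate only if \<open>r = \<plusminus>p\<close>, and then a preimage can be written down
  (lemma \<open>p_q_attain\<close>).

  The omitted points are exactly the critical points of \<open>\<phi>(z) = z\<^sup>3 - 3z\<close>, so the
  composition is still nonsingular everywhere. It is onto because every complex number has a
  \<open>\<phi>\<close>-preimage other than \<open>\<plusminus>1\<close>, and not injective because \<open>\<phi>\<close> identifies the
  attained points \<open>0\<close> and \<open>\<surd>3\<close>.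
\<close>

section \<open>A factorization of the polynomial map\<close>

definition h :: "real \<Rightarrow> real \<Rightarrow> real" where
  "h x y = x * (x * y + 1)"

definition s :: "real \<Rightarrow> real \<Rightarrow> real" where
  "s x y = 4 * (h x y)^2 + 2 * (x * y) + 1"

definition r :: "real \<Rightarrow> real \<Rightarrow> real" where
  "r x y = p x y + 2 * h x y"

lemma p_eq: "p x y = 4 * (h x y)^3 + 4 * (x * y) * h x y + h x y + y"
  unfolding p_def h_def by algebra

lemma q_eq: "q x y = - s x y * r x y"
  unfolding p_def q_def h_def r_def s_def by algebra

text \<open>
  Since \<open>h y = xy (xy + 1)\<close>, multiplying \<open>p\<close> by \<open>h\<close> eliminates the isolated \<open>y\<close>: with
  \<open>w = 2h\<^sup>2 + xy\<close> this gives \<open>h p = w\<^sup>2 + w - h\<^sup>2\<close>, and completing squares on both sides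
  (\<open>s = 2w + 1\<close>, \<open>r = p + 2h\<close>) yields the relation.
\<close>
lemma s_r_p_relation: "(s x y)^2 - (r x y)^2 = 1 - (p x y)^2"
proof -
  have "h x y * y = (x * y) * (x * y + 1)"
    unfolding h_def by algebra
  then show ?thesis
    unfolding r_def s_def p_eq by algebra
qed

lemma s_r_not_both_zero: "s x y \<noteq> 0 \<or> r x y \<noteq> 0"
proof (rule ccontr)
  assume "\<not> ?thesis"
  then have s0: "s x y = 0" and r0: "r x y = 0" by auto
  have "p x y = - 2 * h x y"
    using r0 unfolding r_def by simp
  then have h1: "4 * (h x y)^2 = 1"
    using s_r_p_relation[of x y] s0 r0 by (simp add: power2_eq_square)
  then have "x * y + 1 = 0"
    using s0 unfolding s_def by simp
  then have "h x y = 0"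
    unfolding h_def by simp
  then show False using h1 by simp
qed

lemma F_omits_critical_points: "\<not> (q x y = 0 \<and> (p x y)^2 = 1)"
proof
  assume "q x y = 0 \<and> (p x y)^2 = 1"
  then have "s x y = 0 \<or> r x y = 0" "(s x y)^2 = (r x y)^2"
    using s_r_p_relation[of x y] by (auto simp: q_eq)
  then show False using s_r_not_both_zero[of x y] by auto
qed

section \<open>The image\<close>

text \<open>
  The values \<open>R\<close> and \<open>S\<close> prescribe \<open>h = H\<close> and \<open>xy = U\<close>; then \<open>x = h / (xy + 1)\<close> and
  \<open>y = xy (xy + 1) / h\<close> are forced. The two inequations say that \<open>H \<noteq> 0\<close> and
  \<open>U \<noteq> -1\<close>, so that both quotients make sense.
\<close>
lemma solve_for_x_y:
  assumes rel: "S^2 - R^2 = 1 - P^2"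
    and "R \<noteq> P" and "S \<noteq> (R - P)^2 - 1"
  shows "\<exists>x y. p x y = P \<and> q x y = - S * R"
proof -
  define H where "H = (R - P) / 2"
  define U where "U = (S - 1) / 2 - 2 * H^2"
  have RH: "R = P + 2 * H" by (simp add: H_def field_simps)
  have SU: "S = 4 * H^2 + 2 * U + 1" by (simp add: U_def field_simps)
  have H0: "H \<noteq> 0" using assms(2) by (simp add: H_def)
  have "(R - P)^2 = 4 * H^2" by (simp add: RH power2_eq_square)
  then have U1: "U + 1 \<noteq> 0"
    using assms(3) SU by auto
  define x where "x = H / (U + 1)"
  define y where "y = U * (U + 1) / H"
  have xy: "x * y = U" using H0 U1 by (simp add: x_def y_def)
  then have h: "h x y = H" using U1 by (simp add: h_def x_def)
  have "H * P = 4 * H^4 + 4 * U * H^2 + H^2 + U * (U + 1)"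
    using rel unfolding RH SU by algebra
  moreover have "H * y = U * (U + 1)" using H0 by (simp add: y_def)
  ultimately have "H * P = H * (4 * H^3 + 4 * U * H + H + y)"
    by (simp add: algebra_simps power2_eq_square power3_eq_cube power4_eq_xxxx)
  then have p: "p x y = P"
    using H0 by (simp add: p_eq h xy)
  have "s x y = S" "r x y = R"
    by (simp_all add: s_def r_def h p xy SU RH)
  then show ?thesis using p q_eq by auto
qed

text \<open>
  Take a square root \<open>S + iR\<close> of \<open>1 - P\<^sup>2 - 2iQ\<close> and try to recover a point from it or from its
  negative. If \<open>R = \<plusminus>P\<close>, a preimage is found on the curve \<open>h = 0\<close>, that is, on \<open>x = 0\<close> or
  \<open>xy = -1\<close>. Otherwise recovery can only fail for both roots when both lie on the
  degenerate curve of lemma \<open>solve_for_x_y\<close>. Adding and subtracting the two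
  equations gives \<open>R\<^sup>2 + P\<^sup>2 = 1\<close> and \<open>S = -2RP\<close>, which together with
  \<open>S\<^sup>2 - R\<^sup>2 = 1 - P\<^sup>2\<close> leaves \<open>(P, Q) = (\<plusminus>1, 0)\<close> alone.
\<close>
lemma p_q_attain:
  assumes "Q \<noteq> 0 \<or> P^2 \<noteq> 1"
  shows "\<exists>x y. p x y = P \<and> q x y = Q"
proof -
  define S where "S = Re (csqrt (Complex (1 - P^2) (- 2 * Q)))"
  define R where "R = Im (csqrt (Complex (1 - P^2) (- 2 * Q)))"
  have "(Complex S R)^2 = Complex (1 - P^2) (- 2 * Q)"
    unfolding S_def R_def complex_surj by simp
  then have rel: "S^2 - R^2 = 1 - P^2" and Q: "Q = - S * R"
    by (simp_all add: complex_eq_iff Re_power2 Im_power2 mult.commute)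
  \<comment> \<open>The point has \<open>h = 0\<close> and \<open>s = S'\<close>; for \<open>S' = -1\<close> it runs off to infinity as \<open>P\<close> tends
    to \<open>0\<close>, but there \<open>Q = 0\<close> is attained at the origin.\<close>
  have special: ?thesis if "S'^2 = 1" "Q = - S' * P" for S' :: real
  proof -
    consider "S' = 1" | "S' = -1" using \<open>S'^2 = 1\<close> power2_eq_1_iff[of S'] by blast
    then show ?thesis
    proof cases
      case 1
      then have "p 0 P = P \<and> q 0 P = Q" using that by (simp add: p_def q_def)
      then show ?thesis by blast
    next
      case 2
      show ?thesis
      proof (cases "P = 0")
        case True
        then have "p 0 0 = P \<and> q 0 0 = Q" using that by (simp add: p_def q_def)
        then show ?thesis by blast
      next
        case False
        define X where "X = - 1 / P"
        have XP: "X * P = - 1"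
          using False by (simp add: X_def)
        then have h: "h X P = 0" by (simp add: h_def)
        have p: "p X P = P" by (simp add: p_eq h)
        moreover have "q X P = Q"
          using 2 that by (simp add: q_eq s_def r_def h p XP)
        ultimately show ?thesis by blast
      qed
    qed
  qed
  consider "R = P" | "- R = P" | "R \<noteq> P" "S \<noteq> (R - P)^2 - 1"
    | "- R \<noteq> P" "- S \<noteq> (- R - P)^2 - 1"
    | "R \<noteq> P" "- R \<noteq> P" "S = (R - P)^2 - 1" "- S = (- R - P)^2 - 1"
    by blast
  then show ?thesis
  proof cases
    case 1
    then show ?thesis using special[of S] rel Q by simp
  next
    case 2
    then show ?thesis using special[of "- S"] rel Q by auto
  next
    case 3
    then show ?thesis using solve_for_x_y[OF rel] Q by blast
  next
    case 4
    then show ?thesis using solve_for_x_y[of "- S" "- R" P] rel Q by simp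
  next
    case 5
    have circle: "R^2 + P^2 = 1" and S: "S = - 2 * R * P"
      using 5(3,4) by (simp_all add: power2_eq_square algebra_simps)
    have "R^2 * (R^2 - P^2) = 0"
      using rel circle unfolding S by algebra
    moreover have "R^2 \<noteq> P^2"
      using 5(1,2) by (auto simp: power2_eq_iff)
    ultimately have "R = 0" by simp
    then show ?thesis using assms circle S Q by simp
  qed
qed

section \<open>The composition in coordinates\<close>

lemma phi_plane_F_components:
  "(phi_plane \<circ> F) v $ 1 = (p (v$1) (v$2))^3 - 3 * p (v$1) (v$2) * (q (v$1) (v$2))^2 - 3 * p (v$1) (v$2)"
  "(phi_plane \<circ> F) v $ 2 = 3 * (p (v$1) (v$2))^2 * q (v$1) (v$2) - (q (v$1) (v$2))^3 - 3 * q (v$1) (v$2)"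
  by (simp_all add: phi_plane_def complex_to_plane_def plane_to_complex_def F_def phi_def
      power3_eq_cube power2_eq_square algebra_simps)

lemma polynomial_map_phi_plane_F: "polynomial_map (phi_plane \<circ> F)"
proof -
  have [intro]: "real_polynomial_function (\<lambda>v::real^2. v $ i)" for i
    by (rule real_polynomial_function.intros(1)) (rule bounded_linear_vec_nth)
  have [intro]: "real_polynomial_function (\<lambda>v. p (v$1) (v$2))"
    unfolding p_def by (intro real_polynomial_function.intros(2-) real_polynomial_function_power) auto
  have [intro]: "real_polynomial_function (\<lambda>v. q (v$1) (v$2))"
    unfolding q_eq r_def s_def h_def by (intro real_polynomial_function.intros(2-)
        real_polynomial_function_power real_polynomial_function_minus) auto
  show ?thesis
    unfolding polynomial_map_def forall_2 phi_plane_F_components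
    by (intro conjI real_polynomial_function.intros(2-)
        real_polynomial_function_power real_polynomial_function_diff) auto
qed

section \<open>Nonvanishing of the Jacobian determinant\<close>

lemma det_jacobian_plane:
  fixes g :: "real^2 \<Rightarrow> real^2"
  assumes "((\<lambda>v. g v $ 1) has_derivative (\<lambda>d. a * d$1 + b * d$2)) (at v)"
    and "((\<lambda>v. g v $ 2) has_derivative (\<lambda>d. a' * d$1 + b' * d$2)) (at v)"
  shows "det (jacobian g (at v)) = a * b' - b * a'"
proof -
  define D :: "real^2 \<Rightarrow> real^2" where
    "D d = vector [a * d$1 + b * d$2, a' * d$1 + b' * d$2]" for d
  have "(g has_derivative D) (at v)"
    unfolding has_derivative_componentwise_within[of g] Basis_vec_def
    using assms by (auto simp: D_def inner_axis exhaust_2 forall_2)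
  then have "frechet_derivative g (at v) = D"
    by (simp add: frechet_derivative_at[symmetric])
  then show ?thesis
    by (simp add: jacobian_def det_2 matrix_def D_def axis_def)
qed

text \<open>
  The identity for the determinant comes from \<open>dh \<and> dp = s dx \<and> dy\<close>. Differentiating
  \<open>s\<^sup>2 - r\<^sup>2 = 1 - p\<^sup>2\<close> and \<open>q = - s r\<close> and eliminating \<open>ds\<close> gives
  \<open>s dp \<and> dq = (s\<^sup>2 + r\<^sup>2) dr \<and> dp\<close>, where \<open>dr \<and> dp = 2 dh \<and> dp\<close> because \<open>r = p + 2h\<close>.
  Cancelling \<open>s\<close> is legitimate for polynomials; the proof verifies the
  resulting identity by expansion.
\<close>
lemma F_derivative:
  obtains px py qx qy where
    "((\<lambda>v. p (v$1) (v$2)) has_derivative (\<lambda>d. px * d$1 + py * d$2)) (at v)"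
    "((\<lambda>v. q (v$1) (v$2)) has_derivative (\<lambda>d. qx * d$1 + qy * d$2)) (at v)"
    "px * qy - py * qx = 2 * ((s (v$1) (v$2))^2 + (r (v$1) (v$2))^2)"
proof -
  define x where "x = v $ 1"
  define y where "y = v $ 2"
  define hx where "hx = 2 * x * y + 1"
  define hy where "hy = x^2"
  define px where "px = 12 * (h x y)^2 * hx + 4 * y * h x y + 4 * x * y * hx + hx"
  define py where "py = 12 * (h x y)^2 * hy + 4 * x * h x y + 4 * x * y * hy + hy + 1"
  define sx where "sx = 8 * h x y * hx + 2 * y"
  define sy where "sy = 8 * h x y * hy + 2 * x"
  define qx where "qx = - (sx * r x y + s x y * (px + 2 * hx))"
  define qy where "qy = - (sy * r x y + s x y * (py + 2 * hy))"
  have [derivative_intros]: "((\<lambda>v. v $ i) has_derivative (\<lambda>d. d $ i)) (at v)" for i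
    by (rule bounded_linear_imp_has_derivative) (rule bounded_linear_vec_nth)
  have [derivative_intros]: "((\<lambda>v. h (v$1) (v$2)) has_derivative (\<lambda>d. hx * d$1 + hy * d$2)) (at v)"
    unfolding h_def
    by (rule derivative_eq_intros refl)+
      (simp add: hx_def hy_def x_def y_def fun_eq_iff algebra_simps power2_eq_square)
  have dp [derivative_intros]: "((\<lambda>v. p (v$1) (v$2)) has_derivative (\<lambda>d. px * d$1 + py * d$2)) (at v)"
    unfolding p_eq
    by (rule derivative_eq_intros refl)+
      (simp add: px_def py_def x_def y_def fun_eq_iff algebra_simps power2_eq_square)
  have [derivative_intros]: "((\<lambda>v. s (v$1) (v$2)) has_derivative (\<lambda>d. sx * d$1 + sy * d$2)) (at v)"
    unfolding s_def
    by (rule derivative_eq_intros refl)+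
      (simp add: sx_def sy_def x_def y_def fun_eq_iff algebra_simps power2_eq_square)
  have [derivative_intros]: "((\<lambda>v. r (v$1) (v$2)) has_derivative
      (\<lambda>d. (px + 2 * hx) * d$1 + (py + 2 * hy) * d$2)) (at v)"
    unfolding r_def
    by (rule derivative_eq_intros refl)+ (simp add: fun_eq_iff algebra_simps)
  have dq: "((\<lambda>v. q (v$1) (v$2)) has_derivative (\<lambda>d. qx * d$1 + qy * d$2)) (at v)"
    unfolding q_eq
    by (rule derivative_eq_intros refl)+
      (simp add: qx_def qy_def x_def y_def fun_eq_iff algebra_simps)
  have jac_F: "px * qy - py * qx = 2 * ((s x y)^2 + (r x y)^2)"
    unfolding qx_def qy_def sx_def sy_def px_def py_def r_def s_def p_eq hx_def hy_def h_def
    by algebra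
  show thesis
    by (rule that[OF dp dq jac_F[unfolded x_def y_def]])
qed

text \<open>
  Here \<open>A + iB\<close> is the complex derivative \<open>3 (z\<^sup>2 - 1)\<close> of \<open>\<phi>\<close> at \<open>z = p + iq\<close>. By the
  Cauchy-Riemann equations \<open>\<phi>\<close> contributes the factor \<open>A\<^sup>2 + B\<^sup>2\<close> to the determinant,
  which vanishes only at the critical points \<open>\<plusminus>1\<close>, and these are omitted by \<open>F\<close>.
\<close>
lemma det_jacobian_phi_plane_F: "det (jacobian (phi_plane \<circ> F) (at v)) \<noteq> 0"
proof -
  define x where "x = v $ 1"
  define y where "y = v $ 2"
  obtain px py qx qy where
    dp [derivative_intros]: "((\<lambda>v. p (v$1) (v$2)) has_derivative (\<lambda>d. px * d$1 + py * d$2)) (at v)"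
    and dq [derivative_intros]: "((\<lambda>v. q (v$1) (v$2)) has_derivative (\<lambda>d. qx * d$1 + qy * d$2)) (at v)"
    and jac_F: "px * qy - py * qx = 2 * ((s x y)^2 + (r x y)^2)"
    unfolding x_def y_def by (rule F_derivative[of v])
  define A where "A = 3 * ((p x y)^2 - (q x y)^2 - 1)"
  define B where "B = 6 * p x y * q x y"
  have d1: "((\<lambda>v. (phi_plane \<circ> F) v $ 1) has_derivative
      (\<lambda>d. (A * px - B * qx) * d$1 + (A * py - B * qy) * d$2)) (at v)"
    unfolding phi_plane_F_components
    by (rule derivative_eq_intros refl)+
      (simp add: A_def B_def x_def y_def fun_eq_iff algebra_simps power2_eq_square)
  have d2: "((\<lambda>v. (phi_plane \<circ> F) v $ 2) has_derivative
      (\<lambda>d. (B * px + A * qx) * d$1 + (B * py + A * qy) * d$2)) (at v)"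
    unfolding phi_plane_F_components
    by (rule derivative_eq_intros refl)+
      (simp add: A_def B_def x_def y_def fun_eq_iff algebra_simps power2_eq_square)
  have "det (jacobian (phi_plane \<circ> F) (at v)) = (A^2 + B^2) * (px * qy - py * qx)"
    unfolding det_jacobian_plane[OF d1 d2] by algebra
  moreover have "A^2 + B^2 \<noteq> 0"
  proof
    assume "A^2 + B^2 = 0"
    then have A: "A = 0" and "B = 0" by (simp_all add: sum_power2_eq_zero_iff)
    then have "q x y = 0" "(p x y)^2 = 1"
      by (auto simp: A_def B_def)
        (smt (verit) zero_le_power2)+
    then show False using F_omits_critical_points by blast
  qed
  moreover have "px * qy - py * qx \<noteq> 0"
    using s_r_not_both_zero[of x y] unfolding jac_F by (simp only: mult_eq_0_iff sum_power2_eq_zero_iff) simp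
  ultimately show ?thesis by simp
qed

section \<open>Surjectivity and failure of injectivity\<close>

text \<open>
  A value taken at a critical point \<open>\<plusminus>1\<close> is taken there as a double root; the three roots of
  \<open>z\<^sup>3 - 3z = c\<close> sum to \<open>0\<close>, so the third one is \<open>\<mp>2\<close>.
\<close>
lemma phi_noncritical_preimage: "\<exists>z. phi z = c \<and> z^2 \<noteq> 1"
proof -
  have "\<exists>z. poly [:- c, - 3, 0, 1:] z = 0"
    by (rule fundamental_theorem_of_algebra_alt) (simp)
  then obtain z where z: "phi z = c"
    by (auto simp: phi_def algebra_simps power3_eq_cube)
  show ?thesis
  proof (cases "z^2 = 1")
    case True
    have "phi (- 2 * z) = phi z"
    proof -
      have "z ^ 3 = z"
        using True by (simp add: power3_eq_cube power2_eq_square)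
      then show ?thesis
        by (simp add: phi_def power_mult_distrib)
    qed
    moreover have "(- 2 * z)^2 \<noteq> 1"
      using True by (simp add: power_mult_distrib)
    ultimately show ?thesis using z by (intro exI[of _ "- 2 * z"]) simp
  qed (use z in blast)
qed

lemma F_attains_complex:
  assumes "z^2 \<noteq> 1"
  shows "\<exists>v. plane_to_complex (F v) = z"
proof -
  have "Im z \<noteq> 0 \<or> (Re z)^2 \<noteq> 1"
    using assms by (auto simp: complex_eq_iff Re_power2 Im_power2 power2_eq_square)
  then obtain x y where "p x y = Re z" "q x y = Im z"
    using p_q_attain by blast
  then have "plane_to_complex (F (vector [x, y])) = z"
    by (simp add: plane_to_complex_def F_def)
  then show ?thesis ..
qed

theorem proposition2p2:
  fixes f :: "real^2 \<Rightarrow> real^2"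
  defines "f \<equiv> phi_plane \<circ> F"
  shows "polynomial_map f \<and> \<not> inj f \<and> surj f \<and> (\<forall>v. det (jacobian f (at v)) \<noteq> 0)"
proof (intro conjI allI)
  show "surj f"
    unfolding surj_def
  proof
    fix w
    obtain z where "phi z = plane_to_complex w" "z^2 \<noteq> 1"
      using phi_noncritical_preimage by blast
    moreover obtain v where "plane_to_complex (F v) = z"
      using F_attains_complex \<open>z^2 \<noteq> 1\<close> by blast
    ultimately have "f v = w"
      by (simp add: f_def phi_plane_def complex_to_plane_def plane_to_complex_def vec_eq_iff forall_2)
    then show "\<exists>v. w = f v" by blast
  qed
  show "\<not> inj f"
  proof
    assume "inj f"
    define c where "c = complex_of_real (sqrt 3)"
    have c2: "c^2 = 3" by (simp add: c_def flip: of_real_power)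
    obtain v where v: "plane_to_complex (F v) = 0" using F_attains_complex[of 0] by auto
    obtain w where w: "plane_to_complex (F w) = c" using F_attains_complex[of c] c2 by auto
    have "phi c = phi 0"
      using c2 by (simp add: phi_def power3_eq_cube power2_eq_square)
    then have "f v = f w" by (simp add: f_def phi_plane_def v w)
    then have "v = w" using \<open>inj f\<close> by (simp add: inj_eq)
    then show False using v w c2 by simp
  qed
qed (unfold f_def, rule polynomial_map_phi_plane_F, rule det_jacobian_phi_plane_F)

end
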